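(* Let $n\ge 2$ and let $P_n$ be the path with vertex set $\{1,2,\ldots,n\}$ and edge set $\{(1,2),(2,3),\ldots,(n-1,n)\}$. Then the total number of spanning rooted forests of $P_n$ is $f=\mathcal F_{2n}$, and for all $i,j\in\{1,\ldots,n\}$ the number $f_{ij}$ of spanning rooted forests of $P_n$ in which $j$ belongs to the tree rooted at $i$ equals $$f_{ij}=\mathcal F_{2\min(i,j)-1}\cdot \mathcal F_{2(n+1-\max(i,j))-1}.$$
   Context: $(\mathcal F_k)_{k\ge0}$ denotes the Fibonacci numbers: $\mathcal F_0=0$, $\mathcal F_1=1$, $\mathcal F_{k+2}=\mathcal F_{k+1}+\mathcal F_k$. A spanning rooted forest of a graph $G$ is a spanning acyclic subgraph of $G$ in which exactly one vertex (the root) is marked in each tree. For vertices $i,j$, $f_{ij}$ is the number of spanning rooted forests in which $i$ and $j$ lie in the same tree and that tree is rooted at $i$ (so $f_{ii}$ counts forests in which $i$ is a root); $f$ is the total number of spanning rooted forests. *)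

theory Defs
  imports "HOL-Number_Theory.Fib"
begin

text \<open>Simple graphs are given by a vertex set \<open>V\<close> and a set \<open>E\<close> of two-element subsets of \<open>V\<close>.
  A spanning subgraph has the same vertex set, so it is determined by its edge set \<open>F \<subseteq> E\<close>.\<close>

definition is_cycle :: "'a set set \<Rightarrow> 'a list \<Rightarrow> bool" where
  "is_cycle F vs \<longleftrightarrow> length vs \<ge> 3 \<and> distinct vs \<and>
     (\<forall>k<length vs. {vs ! k, vs ! (Suc k mod length vs)} \<in> F)"

definition acyclic_edges :: "'a set set \<Rightarrow> bool" where
  "acyclic_edges F \<longleftrightarrow> (\<nexists>vs. is_cycle F vs)"

definition joined :: "'a set set \<Rightarrow> 'a \<Rightarrow> 'a \<Rightarrow> bool" where
  "joined F = (\<lambda>u v. {u, v} \<in> F)\<^sup>*\<^sup>*"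

definition component :: "'a set \<Rightarrow> 'a set set \<Rightarrow> 'a \<Rightarrow> 'a set" where
  "component V F v = {w \<in> V. joined F v w}"

definition components :: "'a set \<Rightarrow> 'a set set \<Rightarrow> 'a set set" where
  "components V F = component V F ` V"

text \<open>A rooted forest is a pair \<open>(F, R)\<close> of its edge set and its set of marked vertices.\<close>

definition spanning_rooted_forests :: "'a set \<Rightarrow> 'a set set \<Rightarrow> ('a set set \<times> 'a set) set" where
  "spanning_rooted_forests V E = {(F, R). F \<subseteq> E \<and> acyclic_edges F \<and> R \<subseteq> V \<and>
     (\<forall>T \<in> components V F. \<exists>!r. r \<in> T \<and> r \<in> R)}"

definition num_forests :: "'a set \<Rightarrow> 'a set set \<Rightarrow> nat" where
  "num_forests V E = card (spanning_rooted_forests V E)"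

definition num_forests_rooted :: "'a set \<Rightarrow> 'a set set \<Rightarrow> 'a \<Rightarrow> 'a \<Rightarrow> nat" where
  "num_forests_rooted V E i j =
     card {(F, R) \<in> spanning_rooted_forests V E. \<exists>T \<in> components V F. i \<in> T \<and> j \<in> T \<and> i \<in> R}"

definition path_vertices :: "nat \<Rightarrow> nat set" where
  "path_vertices n = {1..n}"

definition path_edges :: "nat \<Rightarrow> nat set set" where
  "path_edges n = {{k, k + 1} | k. 1 \<le> k \<and> k < n}"

end

theory Submission
  imports Defs
begin

text \<open>A spanning subgraph of the path is a set \<open>E\<close> of left endpoints of edges, and two vertices are
  joined iff the interval between them lies in \<open>E\<close>. Scan the path from left to right: besides the
  forests on \<open>{1..n}\<close>, count the configurations in which only the last component still lacks a
  root. Deciding whether the vertex \<open>n + 1\<close> is joined to \<open>n\<close> and whether it is a root gives, for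
  the two counts \<open>a\<close> and \<open>b\<close>, the recurrence \<open>a' = 2 a + b\<close>, \<open>b' = a + b\<close> of the Fibonacci numbers
  of even and odd index. The numbers \<open>f\<^sub>i\<^sub>j\<close> come from the same scan, with the edges between
  \<open>i\<close> and \<open>j\<close> and the root \<open>i\<close> prescribed.\<close>

subsection \<open>Subgraphs of a path\<close>

definition edges_from :: "nat set \<Rightarrow> nat set set" where
  "edges_from E = (\<lambda>k. {k, k + 1}) ` E"

lemma doubleton_in_edges_from:
  "{u, v} \<in> edges_from E \<longleftrightarrow> v = Suc u \<and> u \<in> E \<or> u = Suc v \<and> v \<in> E"
  by (auto simp: edges_from_def doubleton_eq_iff)

lemma inj_edges_from: "inj edges_from"
proof (rule injI)
  fix A B assume "edges_from A = edges_from B"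
  moreover have "k \<in> E \<longleftrightarrow> {k, Suc k} \<in> edges_from E" for k E
    by (auto simp: doubleton_in_edges_from)
  ultimately show "A = B" by blast
qed

lemma path_edges_eq: "path_edges n = edges_from {1..<n}"
  by (auto simp: path_edges_def edges_from_def)

lemma subset_path_edges_iff: "F \<subseteq> path_edges n \<longleftrightarrow> (\<exists>E\<subseteq>{1..<n}. F = edges_from E)"
  unfolding path_edges_eq edges_from_def by (rule subset_image_iff)

text \<open>On a path there is only one way from \<open>u\<close> to \<open>v\<close>. A walk
  enlarges the interval between its start and its current vertex by at most the edge it traverses;
  conversely a full interval can be walked in both directions.\<close>

lemma joined_edges_from_iff: "joined (edges_from E) u v \<longleftrightarrow> {min u v..<max u v} \<subseteq> E"
proof
  assume "joined (edges_from E) u v"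
  then show "{min u v..<max u v} \<subseteq> E"
    unfolding joined_def
  proof (induction rule: rtranclp_induct)
    case base
    then show ?case by simp
  next
    case (step y z)
    have "k \<in> E" if "k \<in> {min u z..<max u z}" for k
    proof (cases "k \<in> {min u y..<max u y}")
      case True
      then show ?thesis using step.IH by blast
    next
      case False
      \<comment> \<open>The interval grew, and its only new element is the left endpoint of the edge
        just walked.\<close>
      then have "k = y \<and> z = Suc y \<or> k = z \<and> y = Suc z"
        using that step.hyps(2) by (auto simp: doubleton_in_edges_from min_def max_def split: if_splits)
      then show ?thesis using step.hyps(2) by (auto simp: doubleton_in_edges_from)
    qed
    then show ?case by blast
  qed
next
  have up: "joined (edges_from E) a (a + d) \<and> joined (edges_from E) (a + d) a"
    if "{a..<a + d} \<subseteq> E" for a d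
    using that
  proof (induction d)
    case 0
    then show ?case by (simp add: joined_def)
  next
    case (Suc d)
    have "{a..<a + d} \<subseteq> E" "a + d \<in> E" using Suc.prems by auto
    with Suc.IH show ?case
      unfolding joined_def
      by (auto simp: doubleton_in_edges_from
          intro: rtranclp.rtrancl_into_rtrancl converse_rtranclp_into_rtranclp)
  qed
  assume "{min u v..<max u v} \<subseteq> E"
  then show "joined (edges_from E) u v"
    using up[of u "v - u"] up[of v "u - v"] by (cases "u \<le> v") auto
qed

text \<open>Both neighbours on a cycle of its largest vertex \<open>m\<close> would have to be \<open>m - 1\<close>.\<close>

lemma acyclic_edges_from: "acyclic_edges (edges_from E)"
  unfolding acyclic_edges_def
proof
  assume "\<exists>vs. is_cycle (edges_from E) vs"
  then obtain vs where len: "length vs \<ge> 3" and dist: "distinct vs"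
    and edge: "\<And>k. k < length vs \<Longrightarrow> {vs ! k, vs ! (Suc k mod length vs)} \<in> edges_from E"
    by (auto simp: is_cycle_def)
  define L where "L = length vs"
  have "Max (set vs) \<in> set vs" using len by (intro Max_in) auto
  then obtain k where k: "k < L" "vs ! k = Max (set vs)"
    by (auto simp: in_set_conv_nth L_def)
  have le: "vs ! l \<le> vs ! k" if "l < L" for l
    unfolding k(2) using that by (simp add: L_def)
  \<comment> \<open>\<open>p\<close> and \<open>q\<close> are the cyclic neighbours of position
    \<open>k\<close>; length at least 3 makes them distinct.\<close>
  define p where "p = (if k = 0 then L - 1 else k - 1)"
  define q where "q = Suc k mod L"
  have q_eq: "q = (if Suc k = L then 0 else Suc k)" using k by (auto simp: q_def)
  have bounds: "p < L" "q < L" "Suc p mod L = k" "p \<noteq> q"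
    using k len unfolding q_eq p_def by (auto simp: L_def)
  have "Suc (vs ! q) = vs ! k"
    using edge[of k] le[of q] k(1) bounds(2)
    unfolding doubleton_in_edges_from L_def[symmetric] q_def[symmetric] by auto
  moreover have "Suc (vs ! p) = vs ! k"
    using edge[of p] le[of p] bounds
    unfolding doubleton_in_edges_from L_def[symmetric] by auto
  ultimately have "vs ! p = vs ! q" by simp
  then show False using dist bounds by (simp add: nth_eq_iff_index_eq L_def)
qed

text \<open>By \<open>joined_edges_from_iff\<close> these are the marked vertices in the component
  of \<open>v\<close>, expressed by intervals only.\<close>

definition roots_at :: "nat set \<Rightarrow> nat set \<Rightarrow> nat \<Rightarrow> nat set" where
  "roots_at E R v = {r \<in> R. {min r v..<max r v} \<subseteq> E}"

text \<open>In the state \<open>s = False\<close> the component of \<open>n\<close> has no root yet.\<close>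

definition rooted_upto :: "bool \<Rightarrow> nat \<Rightarrow> nat set \<Rightarrow> nat set \<Rightarrow> bool" where
  "rooted_upto s n E R \<longleftrightarrow>
     (\<forall>v\<in>{1..n}. \<not> {v..<n} \<subseteq> E \<longrightarrow> is_singleton (roots_at E R v)) \<and>
     (if s then is_singleton (roots_at E R n) else roots_at E R n = {})"

text \<open>Such a \<open>v\<close> lies in the component of \<open>n\<close>: the intervals from a
  root to \<open>v\<close> and to \<open>n\<close> differ only by edges of
  \<open>{v..<n}\<close>.\<close>

lemma roots_at_eq_last:
  assumes "{v..<n} \<subseteq> E" "v \<le> n" "R \<subseteq> {1..n}"
  shows "roots_at E R v = roots_at E R n"
proof -
  have "{min r v..<max r v} \<subseteq> E \<longleftrightarrow> {r..<n} \<subseteq> E" if "r \<le> n" for r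
  proof
    assume *: "{min r v..<max r v} \<subseteq> E"
    have "{r..<n} \<subseteq> {min r v..<max r v} \<union> {v..<n}" by auto
    then show "{r..<n} \<subseteq> E" using * assms(1) by blast
  next
    assume *: "{r..<n} \<subseteq> E"
    have "{min r v..<max r v} \<subseteq> {r..<n} \<union> {v..<n}" using that assms(2) by auto
    then show "{min r v..<max r v} \<subseteq> E" using * assms(1) by blast
  qed
  moreover have "r \<le> n" if "r \<in> R" for r using that assms(3) by auto
  ultimately show ?thesis by (simp add: roots_at_def cong: conj_cong)
qed

text \<open>The vertices exempt from the first clause of \<open>rooted_upto\<close> lie in the
  component of \<open>n\<close>, which the second clause controls.\<close>

lemma rooted_upto_True_iff:
  assumes "n \<ge> 1" "R \<subseteq> {1..n}"
  shows "rooted_upto True n E R \<longleftrightarrow> (\<forall>v\<in>{1..n}. is_singleton (roots_at E R v))"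
proof -
  have "roots_at E R v = roots_at E R n" if "v \<in> {1..n}" "{v..<n} \<subseteq> E" for v
    using that roots_at_eq_last assms(2) by simp
  moreover have "n \<in> {1..n}" using assms(1) by simp
  ultimately show ?thesis unfolding rooted_upto_def if_True by metis
qed

lemma is_singleton_iff_ex1: "is_singleton A \<longleftrightarrow> (\<exists>!x. x \<in> A)"
  by (auto simp: is_singleton_def)

lemma roots_at_component:
  "R \<subseteq> V \<Longrightarrow> component V (edges_from E) v \<inter> R = roots_at E R v"
  by (auto simp: component_def roots_at_def joined_edges_from_iff min.commute max.commute)

lemma rooted_forest_path_iff:
  assumes "n \<ge> 1"
  shows "(edges_from E, R) \<in> spanning_rooted_forests {1..n} (edges_from {1..<n}) \<longleftrightarrow>
    E \<subseteq> {1..<n} \<and> R \<subseteq> {1..n} \<and> rooted_upto True n E R"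
proof -
  have "edges_from E \<subseteq> edges_from {1..<n} \<longleftrightarrow> E \<subseteq> {1..<n}"
    using inj_edges_from subset_path_edges_iff[of "edges_from E" n]
    by (auto simp: path_edges_eq dest: injD)
  moreover have "(\<exists>!r. r \<in> component {1..n} (edges_from E) v \<and> r \<in> R) \<longleftrightarrow>
      is_singleton (roots_at E R v)" if "R \<subseteq> {1..n}" for v
    unfolding roots_at_component[OF that, symmetric] is_singleton_iff_ex1 by simp
  ultimately show ?thesis
    using assms
    by (simp add: spanning_rooted_forests_def components_def acyclic_edges_from
        rooted_upto_True_iff cong: conj_cong)
qed

subsection \<open>Adding one vertex\<close>

context
  fixes n :: nat and E R :: "nat set"
  assumes E: "E \<subseteq> {1..<n}" and R: "R \<subseteq> {1..n}"
begin

lemma roots_at_insert_edge: "v \<le> n \<Longrightarrow> roots_at (insert n E) R v = roots_at E R v"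
proof -
  assume "v \<le> n"
  then have "n \<notin> {min r v..<max r v}" if "r \<in> R" for r using that R by (auto simp: max_def)
  then show ?thesis unfolding roots_at_def by blast
qed

text \<open>The edge with left endpoint \<open>n\<close> is absent from \<open>E\<close>, so no
  earlier vertex is joined to \<open>Suc n\<close>.\<close>

lemma last_interval_subset: "v \<le> n \<Longrightarrow> \<not> {v..<Suc n} \<subseteq> E"
  using E by (auto simp: subset_iff)

lemma last_interval_subset_insert: "v \<le> n \<Longrightarrow> {v..<Suc n} \<subseteq> insert n E \<longleftrightarrow> {v..<n} \<subseteq> E"
  by (auto simp: subset_iff less_Suc_eq)

lemma roots_at_insert_root: "v \<le> n \<Longrightarrow> roots_at E (insert (Suc n) R) v = roots_at E R v"
  using last_interval_subset[of v] by (auto simp: roots_at_def)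

lemma roots_at_new: "roots_at E R (Suc n) = {}"
proof -
  have "\<not> {min r (Suc n)..<max r (Suc n)} \<subseteq> E" if "r \<in> R" for r
    using that R last_interval_subset[of r] by (auto simp: min_def max_def)
  then show ?thesis by (auto simp: roots_at_def)
qed

lemma roots_at_insert_root_new: "roots_at E (insert (Suc n) R) (Suc n) = {Suc n}"
  using roots_at_new by (auto simp: roots_at_def)

lemma roots_at_insert_edge_new: "roots_at (insert n E) R (Suc n) = roots_at E R n"
proof -
  have "{min r (Suc n)..<max r (Suc n)} \<subseteq> insert n E \<longleftrightarrow> {min r n..<max r n} \<subseteq> E" if "r \<in> R" for r
    using that R last_interval_subset_insert[of r] by (auto simp: min_def max_def)
  then show ?thesis by (auto simp: roots_at_def)
qed

lemma roots_at_insert_both: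
  assumes "v \<le> n"
  shows "roots_at (insert n E) (insert (Suc n) R) v =
    (if {v..<n} \<subseteq> E then insert (Suc n) (roots_at E R v) else roots_at E R v)"
  using roots_at_insert_edge[OF assms] last_interval_subset_insert[OF assms] assms
  by (auto simp: roots_at_def)

lemma roots_at_insert_both_new:
  "roots_at (insert n E) (insert (Suc n) R) (Suc n) = insert (Suc n) (roots_at E R n)"
  using roots_at_insert_edge_new by (auto simp: roots_at_def)

lemma Suc_notin_roots_at: "Suc n \<notin> roots_at E R v"
  using R by (auto simp: roots_at_def)

lemma is_singleton_insert_root:
  "is_singleton (insert (Suc n) (roots_at E R v)) \<longleftrightarrow> roots_at E R v = {}"
  using Suc_notin_roots_at[of v] by (auto simp: is_singleton_def)

lemma ball_Suc: "(\<forall>v\<in>{1..Suc n}. P v) \<longleftrightarrow> (\<forall>v\<in>{1..n}. P v) \<and> P (Suc n)"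
  by (auto simp: atLeastAtMostSuc_conv)

text \<open>The new vertex enters the last component without bringing a root, so the state carries
  over.\<close>

lemma rooted_upto_insert_edge: "rooted_upto s (Suc n) (insert n E) R \<longleftrightarrow> rooted_upto s n E R"
  unfolding rooted_upto_def ball_Suc
  by (simp add: roots_at_insert_edge last_interval_subset_insert roots_at_insert_edge_new
      Ball_def cong: imp_cong)

text \<open>A root at the new vertex serves the component of \<open>n\<close> too, which must
  therefore have been rootless.\<close>

lemma rooted_upto_insert_both:
  "rooted_upto s (Suc n) (insert n E) (insert (Suc n) R) \<longleftrightarrow> s \<and> rooted_upto False n E R"
  unfolding rooted_upto_def ball_Suc
  by (simp add: roots_at_insert_both last_interval_subset_insert roots_at_insert_both_new
      is_singleton_insert_root Ball_def cong: imp_cong)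

text \<open>Omitting the edge closes the component of \<open>n\<close>, so it needs its root
  already; the new vertex starts a rootless component.\<close>

lemma rooted_upto_new:
  assumes "n \<ge> 1"
  shows "rooted_upto s (Suc n) E R \<longleftrightarrow> \<not> s \<and> rooted_upto True n E R"
  unfolding rooted_upto_True_iff[OF assms R] unfolding rooted_upto_def ball_Suc
  by (simp add: last_interval_subset roots_at_new is_singleton_def Ball_def cong: imp_cong)

lemma rooted_upto_insert_root:
  assumes "n \<ge> 1"
  shows "rooted_upto s (Suc n) E (insert (Suc n) R) \<longleftrightarrow> s \<and> rooted_upto True n E R"
  unfolding rooted_upto_True_iff[OF assms R] unfolding rooted_upto_def ball_Suc
  by (simp add: last_interval_subset roots_at_insert_root roots_at_insert_root_new Ball_def cong: imp_cong)

end

subsection \<open>Counting with prescribed edges and roots\<close>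

text \<open>\<open>C\<close> prescribes edges and \<open>M\<close> prescribes roots. Both are cut
  down to the current range, so that the same \<open>C\<close> and \<open>M\<close> serve at every
  stage of the scan.\<close>

definition configs :: "nat set \<Rightarrow> nat set \<Rightarrow> bool \<Rightarrow> nat \<Rightarrow> (nat set \<times> nat set) set" where
  "configs C M s n = {(E, R). E \<subseteq> {1..<n} \<and> R \<subseteq> {1..n} \<and> C \<inter> {1..<n} \<subseteq> E \<and> M \<inter> {1..n} \<subseteq> R \<and>
     rooted_upto s n E R}"

lemma finite_configs: "finite (configs C M s n)"
  by (rule finite_subset[of _ "Pow {1..<n} \<times> Pow {1..n}"]) (auto simp: configs_def)

lemma subset_insert_cases:
  assumes "A \<subseteq> insert x B"
  shows "\<exists>A'\<subseteq>B. A = A' \<or> A = insert x A'"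
  using assms by (metis subset_insert_iff insert_Diff)

text \<open>The three parts are: edge without new root, edge with new root, and no edge. In the last
  part the new vertex is alone, so it is a root exactly when \<open>s\<close> holds. A prescribed
  edge or root deletes the parts that violate it.\<close>

lemma configs_Suc:
  assumes n: "n \<ge> 1"
  shows "configs C M s (Suc n) =
     (if Suc n \<in> M then {} else map_prod (insert n) id ` configs C M s n) \<union>
     (if s then map_prod (insert n) (insert (Suc n)) ` configs C M False n else {}) \<union>
     (if n \<in> C \<or> (Suc n \<in> M \<and> \<not> s) then {}
      else map_prod id (if s then insert (Suc n) else id) ` configs C M True n)"
    (is "?L = ?X \<union> ?Y \<union> ?Z")
proof (intro set_eqI iffI)
  have ivl: "{1..<Suc n} = insert n {1..<n}" "{1..Suc n} = insert (Suc n) {1..n}"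
    using n by auto
  note step = rooted_upto_insert_edge rooted_upto_insert_both rooted_upto_new[OF _ _ n]
    rooted_upto_insert_root[OF _ _ n]
  {
    fix x assume "x \<in> ?L"
    then obtain E R where x: "x = (E, R)" and E: "E \<subseteq> insert n {1..<n}"
      and R: "R \<subseteq> insert (Suc n) {1..n}"
      and C: "C \<inter> insert n {1..<n} \<subseteq> E" and M: "M \<inter> insert (Suc n) {1..n} \<subseteq> R"
      and ok: "rooted_upto s (Suc n) E R"
      unfolding configs_def ivl by blast
    obtain E' where E': "E' \<subseteq> {1..<n}" "E = E' \<or> E = insert n E'"
      using subset_insert_cases[OF E] by metis
    obtain R' where R': "R' \<subseteq> {1..n}" "R = R' \<or> R = insert (Suc n) R'"
      using subset_insert_cases[OF R] by metis
    have fresh: "n \<notin> E'" "Suc n \<notin> R'" using E' R' by auto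
    have conf: "(E', R') \<in> configs C M t n" if "rooted_upto t n E' R'" for t
      using that E' R' C M by (auto simp: configs_def)
    note step' = step[OF E'(1) R'(1)]
    consider "E = E'" "R = R'" | "E = E'" "R = insert (Suc n) R'"
      | "E = insert n E'" "R = R'" | "E = insert n E'" "R = insert (Suc n) R'"
      using E'(2) R'(2) by blast
    then show "x \<in> ?X \<union> ?Y \<union> ?Z"
    proof cases
      case 1
      then have "\<not> s" "n \<notin> C" "Suc n \<notin> M" "(E', R') \<in> configs C M True n"
        using C M ok fresh step' conf by auto
      then show ?thesis using x 1 by (force simp: image_iff)
    next
      case 2
      then have "s" "n \<notin> C" "(E', R') \<in> configs C M True n"
        using C ok fresh step' conf by auto
      then show ?thesis using x 2 by (force simp: image_iff)
    next
      case 3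
      then have "Suc n \<notin> M" "(E', R') \<in> configs C M s n"
        using M ok fresh step' conf by auto
      then show ?thesis using x 3 by (force simp: image_iff)
    next
      case 4
      then have "s" "(E', R') \<in> configs C M False n"
        using ok step' conf by auto
      then show ?thesis using x 4 by (force simp: image_iff)
    qed
  next
    fix x assume "x \<in> ?X \<union> ?Y \<union> ?Z"
    then show "x \<in> ?L"
      unfolding configs_def ivl by (auto simp: step split: if_splits)
  }
qed

text \<open>The parts are told apart by \<open>n \<in> E\<close> and \<open>Suc n \<in> R\<close>,
  and the insertions are injective because both elements are fresh.\<close>

lemma card_configs_Suc:
  assumes n: "n \<ge> 1"
  shows "card (configs C M s (Suc n)) =
     (if Suc n \<in> M then 0 else card (configs C M s n)) +
     (if s then card (configs C M False n) else 0) +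
     (if n \<in> C \<or> (Suc n \<in> M \<and> \<not> s) then 0 else card (configs C M True n))"
proof -
  have sub: "configs C M t n \<subseteq> {E. n \<notin> E} \<times> {R. Suc n \<notin> R}" for t
    by (auto simp: configs_def)
  have inj: "inj_on (insert x) {A. x \<notin> A}" for x :: nat
    by (auto simp: inj_on_def)
  have inj1: "inj_on (map_prod (insert n) id) (configs C M t n)"
    and inj2: "inj_on (map_prod (insert n) (insert (Suc n))) (configs C M t n)"
    and inj3: "inj_on (map_prod id (if s then insert (Suc n) else id)) (configs C M t n)" for t
    by (rule inj_on_subset[OF map_prod_inj_on sub]; auto intro: inj)+
  define X where "X = (if Suc n \<in> M then {} else map_prod (insert n) id ` configs C M s n)"
  define Y where
    "Y = (if s then map_prod (insert n) (insert (Suc n)) ` configs C M False n else {})"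
  define Z where "Z = (if n \<in> C \<or> (Suc n \<in> M \<and> \<not> s) then {}
    else map_prod id (if s then insert (Suc n) else id) ` configs C M True n)"
  have "X \<subseteq> {E. n \<in> E} \<times> {R. Suc n \<notin> R}" "Y \<subseteq> {E. n \<in> E} \<times> {R. Suc n \<in> R}"
    "Z \<subseteq> {E. n \<notin> E} \<times> UNIV"
    using sub[THEN subsetD] by (fastforce simp: X_def Y_def Z_def split: if_splits)+
  then have "X \<inter> Y = {}" "(X \<union> Y) \<inter> Z = {}" by blast+
  moreover have "finite X" "finite Y" "finite Z"
    by (auto simp: X_def Y_def Z_def finite_configs)
  ultimately have "card (X \<union> Y \<union> Z) = card X + card Y + card Z"
    by (simp add: card_Un_disjoint)
  then show ?thesis
    unfolding configs_Suc[OF n] X_def[symmetric] Y_def[symmetric] Z_def[symmetric]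
    unfolding X_def Y_def Z_def by (simp only: card_image inj1 inj2 inj3 card.empty if_distrib[of card])
qed

section \<open>Fibonacci values of the counts\<close>

lemma configs_one:
  "configs C M True 1 = {({}, {1})}" "configs C M False 1 = (if 1 \<in> M then {} else {({}, {})})"
proof -
  have *: "R \<subseteq> {1} \<longleftrightarrow> R = {} \<or> R = {1}" for R :: "nat set" by auto
  show "configs C M True 1 = {({}, {1})}"
    "configs C M False 1 = (if 1 \<in> M then {} else {({}, {})})"
    by (auto simp: configs_def rooted_upto_def roots_at_def is_singleton_def *)
qed

lemma card_configs_free:
  assumes "n \<ge> 1" "C \<inter> {1..<n} = {}" "M \<inter> {1..n} = {}"
  shows "card (configs C M True n) = fib (2 * n) \<and> card (configs C M False n) = fib (2 * n - 1)"
  using assms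
proof (induction n rule: nat_induct_at_least)
  case base
  then show ?case using configs_one[of C M] by (simp add: numeral_2_eq_2)
next
  case (Suc n)
  then have "C \<inter> {1..<n} = {}" "M \<inter> {1..n} = {}" "n \<notin> C" "Suc n \<notin> M" by auto
  \<comment> \<open>Writing \<open>n\<close> as a successor resolves the truncated
    \<open>2 * n - 1\<close>, so that the recursion of \<open>fib\<close> unfolds.\<close>
  moreover obtain m where "n = Suc m" using Suc.hyps by (cases n) auto
  ultimately show ?case using Suc.IH Suc.hyps by (simp add: card_configs_Suc)
qed

text \<open>Across a prescribed edge, the state stays unrooted only if the new vertex is not a root:
  one extension each.\<close>

lemma card_configs_False_along:
  assumes "m \<ge> 1" "{m..<m + d} \<subseteq> C" "M \<inter> {m<..m + d} = {}"
  shows "card (configs C M False (m + d)) = card (configs C M False m)"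
  using assms(2,3)
proof (induction d)
  case (Suc d)
  then have "{m..<m + d} \<subseteq> C" "M \<inter> {m<..m + d} = {}" "m + d \<in> C" "Suc (m + d) \<notin> M" by auto
  then show ?case using Suc.IH assms(1) by (simp add: card_configs_Suc)
qed simp

text \<open>A root could only be added to an unrooted configuration, and there are none.\<close>

lemma card_configs_True_along:
  assumes "m \<ge> 1" "{m..<m + d} \<subseteq> C" "M \<inter> {m<..m + d} = {}" "card (configs C M False m) = 0"
  shows "card (configs C M True (m + d)) = card (configs C M True m)"
  using assms(2,3)
proof (induction d)
  case (Suc d)
  then have "{m..<m + d} \<subseteq> C" "M \<inter> {m<..m + d} = {}" "m + d \<in> C" "Suc (m + d) \<notin> M" by auto
  then show ?case
    using Suc.IH assms card_configs_False_along[of m d C M] by (simp add: card_configs_Suc)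
qed simp

text \<open>This is the free recurrence started from a multiple of \<open>(1, 0)\<close>, that is of
  \<open>(fib 1, fib 0)\<close>, instead of \<open>(fib 2, fib 1)\<close>; hence the index
  shift.\<close>

lemma card_configs_free_after:
  assumes "m \<ge> 1" "C \<inter> {m..} = {}" "M \<inter> {m<..} = {}" "card (configs C M False m) = 0"
  shows "card (configs C M True (m + d)) = card (configs C M True m) * fib (2 * d + 1) \<and>
    card (configs C M False (m + d)) = card (configs C M True m) * fib (2 * d)"
proof (induction d)
  case 0
  then show ?case using assms by simp
next
  case (Suc d)
  have "m + d \<notin> C" "Suc (m + d) \<notin> M" using assms by auto
  then show ?case using Suc.IH assms(1) by (simp add: card_configs_Suc algebra_simps)
qed

text \<open>With \<open>i = Suc m\<close>, either \<open>i\<close> is joined to a rootless component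
  of \<open>m\<close>, or everything up to \<open>m\<close> is complete:
  \<open>fib (2 * m - 1) + fib (2 * m) = fib (2 * m + 1)\<close>.\<close>

lemma card_configs_at_root:
  assumes "i \<ge> 1" "C \<inter> {1..<i} = {}"
  shows "card (configs C {i} True i) = fib (2 * i - 1) \<and> card (configs C {i} False i) = 0"
proof (cases "i = 1")
  case True
  then show ?thesis by (simp add: configs_one flip: One_nat_def)
next
  case False
  then obtain m where m: "i = Suc m" "m \<ge> 1" using assms(1) by (cases i) auto
  then have "C \<inter> {1..<m} = {}" "m \<notin> C" using assms by auto
  then show ?thesis
    using m card_configs_free[of m C "{i}"] by (cases m) (auto simp: card_configs_Suc)
qed

lemma card_configs_upto_max:
  assumes "i \<ge> 1" "j \<ge> 1"
  defines "C \<equiv> {min i j..<max i j}"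
  shows "card (configs C {i} True (max i j)) = fib (2 * min i j - 1) \<and>
    card (configs C {i} False (max i j)) = 0"
proof (cases "i \<le> j")
  case True
  \<comment> \<open>Here the root comes first, and the forced edges up to \<open>j\<close> leave
    both counts unchanged.\<close>
  have "C \<inter> {1..<i} = {}" "{i..<i + (j - i)} \<subseteq> C" using True by (auto simp: C_def)
  then show ?thesis
    using True assms(1) card_configs_at_root[of i C] card_configs_False_along[of i "j - i" C "{i}"]
      card_configs_True_along[of i "j - i" C "{i}"]
    by (simp add: max_def min_def)
next
  case False
  then obtain d where i: "i = Suc (j + d)" by (metis less_iff_Suc_add not_le)
  have C: "C = {j..<i}" using False by (simp add: C_def)
  \<comment> \<open>Here the root comes last: the scan is free up to \<open>j\<close>, and the
    component of \<open>j\<close> must stay unrooted up to the predecessor \<open>j + d\<close> of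
    \<open>i\<close>.\<close>
  have "card (configs C {i} False (j + d)) = fib (2 * j - 1)"
    using assms(2) card_configs_False_along[of j d C "{i}"] card_configs_free[of j C "{i}"]
    by (auto simp: C i)
  moreover have "j + d \<in> C" by (simp add: C i)
  ultimately show ?thesis using False assms(2) by (simp add: i card_configs_Suc)
qed

text \<open>Beyond \<open>max i j\<close> nothing is prescribed and the last component is always
  rooted there, so the remaining \<open>n - max i j\<close> vertices contribute the second
  factor.\<close>

lemma card_configs_between:
  assumes "i \<in> {1..n}" "j \<in> {1..n}"
  shows "card (configs {min i j..<max i j} {i} True n) =
    fib (2 * min i j - 1) * fib (2 * (n + 1 - max i j) - 1)"
proof -
  have "max i j + (n - max i j) = n" "2 * (n + 1 - max i j) - 1 = 2 * (n - max i j) + 1"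
    using assms by auto
  moreover have "card (configs {min i j..<max i j} {i} True (max i j + (n - max i j))) =
      card (configs {min i j..<max i j} {i} True (max i j)) * fib (2 * (n - max i j) + 1)"
    using assms card_configs_upto_max[of i j]
    by (intro card_configs_free_after[THEN conjunct1]) auto
  ultimately show ?thesis using assms card_configs_upto_max[of i j] by simp
qed

section \<open>From configurations back to rooted forests\<close>

lemma card_map_edges_from: "card (map_prod edges_from id ` A) = card A"
  by (intro card_image inj_on_subset[OF prod.inj_map[OF inj_edges_from inj_on_id]]) simp

lemma spanning_rooted_forests_path:
  assumes "n \<ge> 1"
  shows "spanning_rooted_forests {1..n} (path_edges n) =
    map_prod edges_from id ` configs {} {} True n"
proof (intro set_eqI iffI)
  fix x assume x: "x \<in> spanning_rooted_forests {1..n} (path_edges n)"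
  then obtain E R where "x = (edges_from E, R)"
    by (auto simp: spanning_rooted_forests_def subset_path_edges_iff)
  then show "x \<in> map_prod edges_from id ` configs {} {} True n"
    using x rooted_forest_path_iff[OF assms, of E R]
    by (auto simp: path_edges_eq configs_def image_iff)
next
  fix x assume "x \<in> map_prod edges_from id ` configs {} {} True n"
  then show "x \<in> spanning_rooted_forests {1..n} (path_edges n)"
    using rooted_forest_path_iff[OF assms] by (auto simp: path_edges_eq configs_def)
qed

lemma same_component_edges_from_iff:
  assumes "i \<in> V" "j \<in> V"
  shows "(\<exists>T\<in>components V (edges_from E). i \<in> T \<and> j \<in> T) \<longleftrightarrow> {min i j..<max i j} \<subseteq> E"
proof -
  have sym: "joined (edges_from E) u v \<Longrightarrow> joined (edges_from E) v u" for u v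
    by (simp add: joined_edges_from_iff min.commute max.commute)
  have "(\<exists>T\<in>components V (edges_from E). i \<in> T \<and> j \<in> T) \<longleftrightarrow> joined (edges_from E) i j"
  proof
    assume "\<exists>T\<in>components V (edges_from E). i \<in> T \<and> j \<in> T"
    then obtain v where "joined (edges_from E) v i" "joined (edges_from E) v j"
      by (auto simp: components_def component_def)
    then show "joined (edges_from E) i j"
      using sym[of v i] by (auto simp: joined_def)
  next
    assume "joined (edges_from E) i j"
    moreover have "joined (edges_from E) i i" by (simp add: joined_def)
    ultimately show "\<exists>T\<in>components V (edges_from E). i \<in> T \<and> j \<in> T"
      using assms by (auto simp: components_def component_def)
  qed
  then show ?thesis by (simp add: joined_edges_from_iff)
qed

text \<open>Sharing a tree means containing all edges between \<open>i\<close> and \<open>j\<close>,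
  so the condition on the forest becomes a prescription of edges and of one root.\<close>

lemma rooted_forests_path_between:
  assumes "i \<in> {1..n}" "j \<in> {1..n}"
  shows "{(F, R) \<in> spanning_rooted_forests {1..n} (path_edges n).
      \<exists>T\<in>components {1..n} F. i \<in> T \<and> j \<in> T \<and> i \<in> R} =
    map_prod edges_from id ` configs {min i j..<max i j} {i} True n" (is "?L = _")
proof -
  have n: "n \<ge> 1" using assms by auto
  \<comment> \<open>The prescriptions lie within the path, so cutting them down to its range changes
    nothing.\<close>
  have ivl: "{min i j..<max i j} \<inter> {1..<n} = {min i j..<max i j}" "{i} \<inter> {1..n} = {i}"
    using assms by auto
  have key: "(\<exists>T\<in>components {1..n} (edges_from E). i \<in> T \<and> j \<in> T \<and> i \<in> R) \<longleftrightarrow>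
      {min i j..<max i j} \<subseteq> E \<and> i \<in> R" for E R
    unfolding same_component_edges_from_iff[OF assms, symmetric] by blast
  have "?L = {x \<in> map_prod edges_from id ` configs {} {} True n.
      case x of (F, R) \<Rightarrow> \<exists>T\<in>components {1..n} F. i \<in> T \<and> j \<in> T \<and> i \<in> R}"
    unfolding spanning_rooted_forests_path[OF n] by blast
  also have "\<dots> = map_prod edges_from id ` {y \<in> configs {} {} True n.
      case map_prod edges_from id y of
        (F, R) \<Rightarrow> \<exists>T\<in>components {1..n} F. i \<in> T \<and> j \<in> T \<and> i \<in> R}"
    by (rule Compr_image_eq)
  also have "{y \<in> configs {} {} True n. case map_prod edges_from id y of
        (F, R) \<Rightarrow> \<exists>T\<in>components {1..n} F. i \<in> T \<and> j \<in> T \<and> i \<in> R} =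
      {(E, R) \<in> configs {} {} True n. {min i j..<max i j} \<subseteq> E \<and> i \<in> R}"
    by (simp add: key[simplified] case_prod_unfold)
  also have "{(E, R) \<in> configs {} {} True n. {min i j..<max i j} \<subseteq> E \<and> i \<in> R} =
      configs {min i j..<max i j} {i} True n"
    unfolding configs_def ivl by blast
  finally show ?thesis .
qed

theorem theorem1:
  fixes n :: nat
  assumes "n \<ge> 2"
  shows "num_forests (path_vertices n) (path_edges n) = fib (2 * n) \<and>
    (\<forall>i \<in> {1..n}. \<forall>j \<in> {1..n}.
       num_forests_rooted (path_vertices n) (path_edges n) i j =
         fib (2 * min i j - 1) * fib (2 * (n + 1 - max i j) - 1))"
proof (intro conjI ballI)
  have n: "n \<ge> 1" using assms by simp
  show "num_forests (path_vertices n) (path_edges n) = fib (2 * n)"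
    unfolding num_forests_def path_vertices_def spanning_rooted_forests_path[OF n]
      card_map_edges_from using card_configs_free[OF n] by simp
  fix i j assume ij: "i \<in> {1..n}" "j \<in> {1..n}"
  show "num_forests_rooted (path_vertices n) (path_edges n) i j =
      fib (2 * min i j - 1) * fib (2 * (n + 1 - max i j) - 1)"
    unfolding num_forests_rooted_def path_vertices_def rooted_forests_path_between[OF ij]
      card_map_edges_from by (rule card_configs_between[OF ij])
qed

end
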